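(* Assume the Continuum Hypothesis. If $\mathcal{U}$ is a stable ordered-union ultrafilter on $\mathrm{FIN}$, then there is a $(p^+)$-filter $\mathcal{F}$ on $E$ such that $\mathrm{supp}(\mathcal{F})=\mathcal{U}$.
   Context: $E$ is a countably infinite-dimensional vector space over a countable field $F$ with fixed basis $(e_n)$. $\mathrm{supp}(v)$ for nonzero $v$ is the set of $i$ with $e_i$ having nonzero coefficient in $v$. A block sequence is a sequence $(x_n)$ of nonzero vectors with $\max\mathrm{supp}(x_n)<\min\mathrm{supp}(x_{n+1})$; $E^{[\infty]}$ is the set of infinite block sequences; $\langle X\rangle$ is the span of $X$ minus $0$; $Y\preceq X$ iff $\langle Y\rangle\subseteq\langle X\rangle$; $X/n$ is the tail of $X$ of vectors with support above $n$; $Y\preceq^*X$ iff $Y/n\preceq X$ for some $n$. A filter on $E$ is a proper filter of subsets of $E\setminus\{0\}$ containing the nonzero parts of all finite-codimensional subspaces; a block filter is one with a base of sets $\langle X\rangle$, $X\in E^{[\infty]}$. For a block filter $\mathcal{F}$: $D\subseteq E$ is $\mathcal{F}$-dense if for every $\langle X\rangle\in\mathcal{F}$ there is an infinite-dimensional subspace $V\subseteq\langle X\rangle\cup\{0\}$ with $V\setminus\{0\}\subseteq D$; $\mathcal{F}$ is full if every $\mathcal{F}$-dense $D$ belongs to $\mathcal{F}$; $\mathcal{F}$ is a $(p)$-filter if whenever $\langle X_n\rangle\in\mathcal{F}$ for all $n$ there is $\langle X\rangle\in\mathcal{F}$ with $X\preceq^*X_n$ for all $n$; a $(p^+)$-filter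 is a full $(p)$-filter. $\mathrm{FIN}$ is the set of nonempty finite subsets of $\omega$; $\mathrm{FIN}^{[\infty]}$ the set of sequences $(a_n)$ in $\mathrm{FIN}$ with $\max a_n<\min a_{n+1}$; $\langle A\rangle$ the set of finite unions of entries of $A$; $\preceq,\preceq^*$ on $\mathrm{FIN}^{[\infty]}$ defined analogously. $\mathrm{supp}(\mathcal{F})=\{A\subseteq\mathrm{FIN}:\exists S\in\mathcal{F}\,(A\supseteq\{\mathrm{supp}(v):v\in S\})\}$. An ultrafilter $\mathcal{U}$ on $\mathrm{FIN}$ is ordered-union if it has a base of sets $\langle A\rangle$, and stable if whenever $\langle A_n\rangle\in\mathcal{U}$ for all $n$ there is $\langle B\rangle\in\mathcal{U}$ with $B\preceq^* A_n$ for all $n$. *)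

theory Defs
  imports Complex_Main "HOL-Library.Equipollence" "HOL-Library.Countable_Set"
begin

definition continuum_hypothesis :: bool where
  "continuum_hypothesis \<longleftrightarrow> (\<forall>S :: real set. countable S \<or> S \<approx> (UNIV :: real set))"

definition proper_filter_on :: "'a set \<Rightarrow> 'a set set \<Rightarrow> bool" where
  "proper_filter_on T \<F> \<longleftrightarrow>
     \<F> \<subseteq> Pow T \<and> T \<in> \<F> \<and> {} \<notin> \<F> \<and>
     (\<forall>A\<in>\<F>. \<forall>B. A \<subseteq> B \<and> B \<subseteq> T \<longrightarrow> B \<in> \<F>) \<and>
     (\<forall>A\<in>\<F>. \<forall>B\<in>\<F>. A \<inter> B \<in> \<F>)"

definition ultrafilter_on :: "'a set \<Rightarrow> 'a set set \<Rightarrow> bool" where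
  "ultrafilter_on T \<U> \<longleftrightarrow>
     proper_filter_on T \<U> \<and> (\<forall>A. A \<subseteq> T \<longrightarrow> A \<in> \<U> \<or> T - A \<in> \<U>)"

definition FIN :: "nat set set" where
  "FIN = {a. finite a \<and> a \<noteq> {}}"

definition FIN_block_seqs :: "(nat \<Rightarrow> nat set) set" where
  "FIN_block_seqs = {A. (\<forall>n. A n \<in> FIN) \<and> (\<forall>n. Max (A n) < Min (A (Suc n)))}"

definition FIN_span :: "(nat \<Rightarrow> nat set) \<Rightarrow> nat set set" where
  "FIN_span A = {\<Union>(A ` I) | I. finite I \<and> I \<noteq> {}}"

definition FIN_le :: "(nat \<Rightarrow> nat set) \<Rightarrow> (nat \<Rightarrow> nat set) \<Rightarrow> bool" where
  "FIN_le B A \<longleftrightarrow> FIN_span B \<subseteq> FIN_span A"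

definition FIN_tail :: "(nat \<Rightarrow> nat set) \<Rightarrow> nat \<Rightarrow> nat \<Rightarrow> nat set" where
  "FIN_tail A n = (\<lambda>k. A (k + (LEAST m. n < Min (A m))))"

definition FIN_almost_le :: "(nat \<Rightarrow> nat set) \<Rightarrow> (nat \<Rightarrow> nat set) \<Rightarrow> bool" where
  "FIN_almost_le B A \<longleftrightarrow> (\<exists>n. FIN_le (FIN_tail B n) A)"

definition ordered_union_ultrafilter :: "nat set set set \<Rightarrow> bool" where
  "ordered_union_ultrafilter \<U> \<longleftrightarrow>
     ultrafilter_on FIN \<U> \<and>
     (\<forall>S\<in>\<U>. \<exists>A\<in>FIN_block_seqs. FIN_span A \<in> \<U> \<and> FIN_span A \<subseteq> S)"

definition stable_ordered_union_ultrafilter :: "nat set set set \<Rightarrow> bool" where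
  "stable_ordered_union_ultrafilter \<U> \<longleftrightarrow>
     ordered_union_ultrafilter \<U> \<and>
     (\<forall>A :: nat \<Rightarrow> nat \<Rightarrow> nat set.
        (\<forall>n. A n \<in> FIN_block_seqs \<and> FIN_span (A n) \<in> \<U>) \<longrightarrow>
        (\<exists>B\<in>FIN_block_seqs. FIN_span B \<in> \<U> \<and> (\<forall>n. FIN_almost_le B (A n))))"

context vector_space
begin

definition infinite_dim_subspace :: "'b set \<Rightarrow> bool" where
  "infinite_dim_subspace V \<longleftrightarrow>
     subspace V \<and> \<not> (\<exists>B. finite B \<and> B \<subseteq> V \<and> span B = V)"

text \<open>The second conjunct says that the quotient by \<open>V\<close> is spanned by the classes of the
  finitely many elements of \<open>B\<close>.\<close>

definition finite_codim_subspace :: "'b set \<Rightarrow> bool" where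
  "finite_codim_subspace V \<longleftrightarrow>
     subspace V \<and> (\<exists>B. finite B \<and> span (V \<union> B) = UNIV)"

end

locale based_vector_space = vector_space scale
  for scale :: "'a :: field \<Rightarrow> 'b :: ab_group_add \<Rightarrow> 'b" +
  fixes e :: "nat \<Rightarrow> 'b"
  assumes countable_field: "countable (UNIV :: 'a set)"
    and inj_basis: "inj e"
    and independent_basis: "independent (range e)"
    and span_basis: "span (range e) = UNIV"
begin

definition supp :: "'b \<Rightarrow> nat set" where
  "supp v = {i. representation (range e) v (e i) \<noteq> 0}"

definition block_seqs :: "(nat \<Rightarrow> 'b) set" where
  "block_seqs = {X. (\<forall>n. X n \<noteq> 0) \<and> (\<forall>n. Max (supp (X n)) < Min (supp (X (Suc n))))}"

definition nz_span :: "(nat \<Rightarrow> 'b) \<Rightarrow> 'b set" where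
  "nz_span X = span (range X) - {0}"

definition block_le :: "(nat \<Rightarrow> 'b) \<Rightarrow> (nat \<Rightarrow> 'b) \<Rightarrow> bool" where
  "block_le Y X \<longleftrightarrow> nz_span Y \<subseteq> nz_span X"

definition block_tail :: "(nat \<Rightarrow> 'b) \<Rightarrow> nat \<Rightarrow> nat \<Rightarrow> 'b" where
  "block_tail X n = (\<lambda>k. X (k + (LEAST m. n < Min (supp (X m)))))"

definition block_almost_le :: "(nat \<Rightarrow> 'b) \<Rightarrow> (nat \<Rightarrow> 'b) \<Rightarrow> bool" where
  "block_almost_le Y X \<longleftrightarrow> (\<exists>n. block_le (block_tail Y n) X)"

definition vs_filter :: "'b set set \<Rightarrow> bool" where
  "vs_filter \<F> \<longleftrightarrow>
     proper_filter_on (UNIV - {0}) \<F> \<and>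
     (\<forall>V. finite_codim_subspace V \<longrightarrow> V - {0} \<in> \<F>)"

definition block_filter :: "'b set set \<Rightarrow> bool" where
  "block_filter \<F> \<longleftrightarrow>
     vs_filter \<F> \<and>
     (\<forall>S\<in>\<F>. \<exists>X\<in>block_seqs. nz_span X \<in> \<F> \<and> nz_span X \<subseteq> S)"

definition filter_dense :: "'b set set \<Rightarrow> 'b set \<Rightarrow> bool" where
  "filter_dense \<F> D \<longleftrightarrow>
     (\<forall>X\<in>block_seqs. nz_span X \<in> \<F> \<longrightarrow>
        (\<exists>V. infinite_dim_subspace V \<and> V \<subseteq> nz_span X \<union> {0} \<and> V - {0} \<subseteq> D))"

text \<open>Members of a filter never contain \<open>0\<close>, while a dense set may; hence \<open>D - {0}\<close>.\<close>

definition full_filter :: "'b set set \<Rightarrow> bool" where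
  "full_filter \<F> \<longleftrightarrow> (\<forall>D. filter_dense \<F> D \<longrightarrow> D - {0} \<in> \<F>)"

definition p_filter :: "'b set set \<Rightarrow> bool" where
  "p_filter \<F> \<longleftrightarrow>
     block_filter \<F> \<and>
     (\<forall>X :: nat \<Rightarrow> nat \<Rightarrow> 'b.
        (\<forall>n. X n \<in> block_seqs \<and> nz_span (X n) \<in> \<F>) \<longrightarrow>
        (\<exists>Y\<in>block_seqs. nz_span Y \<in> \<F> \<and> (\<forall>n. block_almost_le Y (X n))))"

definition p_plus_filter :: "'b set set \<Rightarrow> bool" where
  "p_plus_filter \<F> \<longleftrightarrow> p_filter \<F> \<and> full_filter \<F>"

definition supp_filter :: "'b set set \<Rightarrow> nat set set set" where
  "supp_filter \<F> = {A. A \<subseteq> FIN \<and> (\<exists>S\<in>\<F>. supp ` S \<subseteq> A)}"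

end

end

theory Submission
  imports Defs "HOL-Analysis.Abstract_Topology_2"
begin

text \<open>
  Call a block sequence \<open>X\<close> good if the supports of \<open>\<langle>X\<rangle>\<close> form a set in \<open>\<U>\<close>. The heart of the proof is a
  dichotomy: below every good \<open>X\<close> and for every set \<open>D\<close> of vectors there is a good \<open>Z\<close> such that
  either \<open>\<langle>Z\<rangle> \<subseteq> D\<close>, or \<open>D\<close> contains no infinite-dimensional subspace of the span of \<open>Z\<close>. To see this,
  call a finite set \<open>B\<close> spoiled if some \<open>S \<in> \<U>\<close> is such that no infinite-dimensional \<open>V\<close> with
  supports in \<open>S\<close> has \<open>span (B \<union> V) - {0} \<subseteq> D\<close>. By stability, if \<open>B\<close> is not spoiled, then for
  \<open>\<U>\<close>-many \<open>a\<close> there is a vector \<open>y\<close> of support \<open>a\<close> with \<open>insert y B\<close> not spoiled. If the empty set is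
  not spoiled, one diagonalises these sets: stability gives a pseudointersection, and \<open>\<U>\<close> contains
  the spans of arbitrarily sparse block sequences.

  Under CH the sets of vectors are well-ordered with countable initial segments. By recursion along
  this order one picks good sequences, decreasing modulo finite, the \<open>D\<close>-th of which decides \<open>D\<close>;
  stability carries the recursion through countable stages. These sequences generate the filter.
\<close>

section \<open>Well-orders under the Continuum Hypothesis\<close>

text \<open>In the cardinal order of the type every proper initial segment has strictly smaller
  cardinality than the type. Carried into the reals, such a segment cannot have the size of the
  continuum, so CH makes it countable.\<close>

lemma CH_wellorder_countable_segments:
  assumes CH: continuum_hypothesis and T: "(UNIV :: 'b set) \<approx> (UNIV :: nat set set)"
  obtains r :: "'b rel" where "wf r" "trans r" "\<And>x. countable {y. (y, x) \<in> r}"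
    "\<And>x y. x \<noteq> y \<Longrightarrow> (x, y) \<in> r \<or> (y, x) \<in> r"
proof -
  let ?R = "card_of (UNIV :: 'b set)"
  have wo: "well_order_on UNIV ?R" using card_of_well_order_on[of "UNIV :: 'b set"] by simp
  have "(UNIV :: 'b set) \<lesssim> (UNIV :: real set)"
    using nat_sets_lepoll_reals01 T
    by (meson eqpoll_imp_lepoll lepoll_trans subset_imp_lepoll subset_UNIV)
  then obtain f :: "'b \<Rightarrow> real" where f: "inj f" by (auto simp: lepoll_def)
  show ?thesis
  proof
    show "wf (?R - Id)" using wo by (simp add: well_order_on_def)
    show "trans (?R - Id)"
      using wo by (auto simp: well_order_on_def linear_order_on_def partial_order_on_def
          preorder_on_def intro: trans_diff_Id)
    show "(x, y) \<in> ?R - Id \<or> (y, x) \<in> ?R - Id" if "x \<noteq> y" for x y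
      using wo that by (auto simp: well_order_on_def linear_order_on_def total_on_def)
    show "countable {y. (y, x) \<in> ?R - Id}" for x
    proof -
      let ?S = "{y. (y, x) \<in> ?R - Id}"
      have S: "?S = underS ?R x" by (auto simp: underS_def)
      have lt: "(card_of ?S, ?R) \<in> ordLess"
        unfolding S by (intro card_of_underS) (auto simp: Field_card_of card_of_card_order_on)
      have im: "?S \<approx> f ` ?S"
        using inj_on_subset[OF f subset_UNIV] inj_on_image_eqpoll_self eqpoll_sym by blast
      have "\<not> f ` ?S \<approx> (UNIV :: real set)"
      proof
        assume "f ` ?S \<approx> (UNIV :: real set)"
        \<comment> \<open>Otherwise the whole type would embed, by way of the reals, into one of its
          own proper initial segments.\<close>
        then have "(UNIV :: real set) \<lesssim> ?S"
          using im by (meson eqpoll_imp_lepoll eqpoll_sym eqpoll_trans)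
        then have "(UNIV :: 'b set) \<lesssim> ?S"
          using \<open>(UNIV :: 'b set) \<lesssim> (UNIV :: real set)\<close> lepoll_trans by blast
        then have "(?R, card_of ?S) \<in> ordLeq" unfolding lepoll_def by (simp add: card_of_ordLeq)
        with lt show False using not_ordLess_ordLeq by blast
      qed
      then have "countable (f ` ?S)" using CH by (auto simp: continuum_hypothesis_def)
      then show ?thesis
        by (rule countable_image_inj_on) (rule inj_on_subset[OF f subset_UNIV])
    qed
  qed
qed

section \<open>Ultrafilters on FIN\<close>

lemma FIN_block_memD: "A \<in> FIN_block_seqs \<Longrightarrow> finite (A i) \<and> A i \<noteq> {}"
  by (auto simp: FIN_block_seqs_def FIN_def)

lemma FIN_block_less:
  assumes "A \<in> FIN_block_seqs" "i < j" shows "Max (A i) < Min (A j)"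
  using assms(2)
proof (induction j)
  case (Suc j)
  have "Max (A j) < Min (A (Suc j))" using assms(1) by (auto simp: FIN_block_seqs_def)
  moreover have "Min (A j) \<le> Max (A j)" using FIN_block_memD[OF assms(1)] by simp
  ultimately show ?case using Suc by (cases "i = j") auto
qed simp

lemma FIN_block_ge:
  assumes "A \<in> FIN_block_seqs" shows "j \<le> Min (A j)"
proof (induction j)
  case (Suc j)
  have "Max (A j) < Min (A (Suc j))" using assms(1) by (auto simp: FIN_block_seqs_def)
  moreover have "Min (A j) \<le> Max (A j)" using FIN_block_memD[OF assms(1)] by simp
  ultimately show ?case using Suc by auto
qed simp

lemma FIN_block_disjoint:
  assumes "A \<in> FIN_block_seqs" "x \<in> A i" "x \<in> A j" shows "i = j"
proof -
  have False if "i < j" "x \<in> A i" "x \<in> A j" for i j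
  proof -
    have "finite (A i)" "finite (A j)" using assms(1) by (auto simp: FIN_block_seqs_def FIN_def)
    then have "Min (A j) \<le> x" "x \<le> Max (A i)" using that by auto
    then show False using FIN_block_less[OF assms(1) that(1)] by simp
  qed
  then show ?thesis using assms by (meson linorder_neqE_nat)
qed

lemma FIN_spanI: "finite I \<Longrightarrow> I \<noteq> {} \<Longrightarrow> \<Union>(A ` I) \<in> FIN_span A"
  by (auto simp: FIN_span_def)

lemma FIN_span_base: "A i \<in> FIN_span A"
  using FIN_spanI[of "{i}" A] by simp

text \<open>A union that uses a block contains the minimum of that block, so its own minimum is no
  larger; this excludes the first \<open>m\<close> blocks.\<close>

lemma FIN_span_shift:
  assumes A: "A \<in> FIN_block_seqs" and a: "a \<in> FIN_span A"
    and m: "\<And>i. i < m \<Longrightarrow> Min (A i) < Min a"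
  shows "a \<in> FIN_span (\<lambda>k. A (k + m))"
proof -
  obtain I where I: "finite I" "I \<noteq> {}" "a = \<Union>(A ` I)" using a by (auto simp: FIN_span_def)
  have fa: "finite a" using I FIN_block_memD[OF A] by auto
  have ge: "m \<le> i" if "i \<in> I" for i
  proof (rule ccontr)
    assume "\<not> m \<le> i"
    then have lt: "Min (A i) < Min a" using m by auto
    have "Min (A i) \<in> A i" using FIN_block_memD[OF A] by simp
    then have "Min (A i) \<in> a" using that I by auto
    then show False using lt fa Min_le leD by blast
  qed
  have "a = \<Union>((\<lambda>k. A (k + m)) ` ((\<lambda>i. i - m) ` I))"
    unfolding I(3) image_image using ge by (intro arg_cong[where f = Union] image_cong) auto
  moreover have "\<dots> \<in> FIN_span (\<lambda>k. A (k + m))" using I by (intro FIN_spanI) auto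
  ultimately show ?thesis by simp
qed

section \<open>Pseudointersections and sparse spans in a stable ordered-union ultrafilter\<close>

locale stable_ou =
  fixes \<U> :: "nat set set set"
  assumes stable: "stable_ordered_union_ultrafilter \<U>"
begin

lemma
  shows U_FIN: "S \<in> \<U> \<Longrightarrow> S \<subseteq> FIN"
    and FIN_in_U: "FIN \<in> \<U>"
    and U_mono: "S \<in> \<U> \<Longrightarrow> S \<subseteq> S' \<Longrightarrow> S' \<subseteq> FIN \<Longrightarrow> S' \<in> \<U>"
    and U_Int: "S \<in> \<U> \<Longrightarrow> S' \<in> \<U> \<Longrightarrow> S \<inter> S' \<in> \<U>"
    and U_ultra: "S \<subseteq> FIN \<Longrightarrow> S \<in> \<U> \<or> FIN - S \<in> \<U>"
proof -
  have *: "\<U> \<subseteq> Pow FIN" "FIN \<in> \<U>"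
    "\<forall>A\<in>\<U>. \<forall>B. A \<subseteq> B \<and> B \<subseteq> FIN \<longrightarrow> B \<in> \<U>"
    "\<forall>A\<in>\<U>. \<forall>B\<in>\<U>. A \<inter> B \<in> \<U>"
    "\<forall>A. A \<subseteq> FIN \<longrightarrow> A \<in> \<U> \<or> FIN - A \<in> \<U>"
    using stable
    unfolding stable_ordered_union_ultrafilter_def ordered_union_ultrafilter_def
      ultrafilter_on_def proper_filter_on_def by simp_all
  show "S \<in> \<U> \<Longrightarrow> S \<subseteq> FIN" using *(1) by blast
  show "FIN \<in> \<U>" by (fact *(2))
  show "S \<in> \<U> \<Longrightarrow> S \<subseteq> S' \<Longrightarrow> S' \<subseteq> FIN \<Longrightarrow> S' \<in> \<U>" using *(3) by simp
  show "S \<in> \<U> \<Longrightarrow> S' \<in> \<U> \<Longrightarrow> S \<inter> S' \<in> \<U>" using *(4) by simp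
  show "S \<subseteq> FIN \<Longrightarrow> S \<in> \<U> \<or> FIN - S \<in> \<U>" using *(5) by simp
qed

lemma U_base:
  assumes "S \<in> \<U>"
  obtains A where "A \<in> FIN_block_seqs" "FIN_span A \<in> \<U>" "FIN_span A \<subseteq> S"
proof -
  have "\<forall>S\<in>\<U>. \<exists>A\<in>FIN_block_seqs. FIN_span A \<in> \<U> \<and> FIN_span A \<subseteq> S"
    using stable
    unfolding stable_ordered_union_ultrafilter_def ordered_union_ultrafilter_def by simp
  with assms that show ?thesis by (meson bspec)
qed

text \<open>Every block sequence has blocks starting beyond \<open>k\<close>, so no
  \<open>FIN_span A\<close> fits into the complement.\<close>

lemma U_tail: "{a \<in> FIN. k < Min a} \<in> \<U>"
proof (rule ccontr)
  assume "\<not> ?thesis"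
  then have "FIN - {a \<in> FIN. k < Min a} \<in> \<U>" using U_ultra[of "{a \<in> FIN. k < Min a}"] by simp
  then obtain A where A: "A \<in> FIN_block_seqs" "FIN_span A \<subseteq> FIN - {a \<in> FIN. k < Min a}"
    by (rule U_base)
  moreover have "k < Min (A (Suc k))" using FIN_block_ge[OF A(1), of "Suc k"] by simp
  ultimately show False using FIN_span_base[of A "Suc k"] by auto
qed

text \<open>Stability for arbitrary members of \<U>. A bound on the minimum of an element replaces
  the tail of the sequence, which is the form that diagonal arguments use.\<close>

lemma U_pseudointersection_seq:
  fixes S :: "nat \<Rightarrow> nat set set"
  assumes "\<And>n. S n \<in> \<U>"
  obtains B where "B \<in> FIN_block_seqs" "FIN_span B \<in> \<U>"
    "\<And>n. \<exists>k. \<forall>a\<in>FIN_span B. k < Min a \<longrightarrow> a \<in> S n"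
proof -
  have "\<forall>n. \<exists>A. A \<in> FIN_block_seqs \<and> FIN_span A \<in> \<U> \<and> FIN_span A \<subseteq> S n"
    using U_base[OF assms] by metis
  then obtain A where A: "\<And>n. A n \<in> FIN_block_seqs" "\<And>n. FIN_span (A n) \<in> \<U>"
    "\<And>n. FIN_span (A n) \<subseteq> S n" by metis
  obtain B where B: "B \<in> FIN_block_seqs" "FIN_span B \<in> \<U>" "\<And>n. FIN_almost_le B (A n)"
    using stable A unfolding stable_ordered_union_ultrafilter_def by metis
  have "\<exists>k. \<forall>a\<in>FIN_span B. k < Min a \<longrightarrow> a \<in> S n" for n
  proof -
    obtain k where k: "FIN_span (FIN_tail B k) \<subseteq> FIN_span (A n)"
      using B(3)[of n] by (auto simp: FIN_almost_le_def FIN_le_def)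
    have "a \<in> S n" if a: "a \<in> FIN_span B" "k < Min a" for a
    proof -
      have "a \<in> FIN_span (FIN_tail B k)"
        unfolding FIN_tail_def
      proof (rule FIN_span_shift[OF B(1) a(1)])
        fix i assume "i < (LEAST m. k < Min (B m))"
        then show "Min (B i) < Min a" using not_less_Least a(2) by fastforce
      qed
      then show ?thesis using k A(3) by blast
    qed
    then show ?thesis by blast
  qed
  with B show ?thesis using that by blast
qed

lemma U_pseudointersection:
  assumes I: "countable I" and S: "\<And>i. i \<in> I \<Longrightarrow> S i \<in> \<U>"
  obtains B k where "B \<in> FIN_block_seqs" "FIN_span B \<in> \<U>"
    "\<And>i a. i \<in> I \<Longrightarrow> a \<in> FIN_span B \<Longrightarrow> k i < Min a \<Longrightarrow> a \<in> S i"
proof (cases "I = {}")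
  case True
  then show ?thesis using U_base[OF FIN_in_U] that by (metis empty_iff)
next
  case False
  then have "S (from_nat_into I n) \<in> \<U>" for n using S from_nat_into by metis
  then obtain B where B: "B \<in> FIN_block_seqs" "FIN_span B \<in> \<U>"
    "\<And>n. \<exists>k. \<forall>a\<in>FIN_span B. k < Min a \<longrightarrow> a \<in> S (from_nat_into I n)"
    using U_pseudointersection_seq[of "\<lambda>n. S (from_nat_into I n)"] by blast
  have "\<forall>i\<in>I. \<exists>k. \<forall>a\<in>FIN_span B. k < Min a \<longrightarrow> a \<in> S i"
  proof
    fix i assume "i \<in> I"
    then obtain n where "from_nat_into I n = i" using from_nat_into_surj[OF I] by blast
    then show "\<exists>k. \<forall>a\<in>FIN_span B. k < Min a \<longrightarrow> a \<in> S i" using B(3)[of n] by simp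
  qed
  then obtain k where "\<forall>i\<in>I. \<forall>a\<in>FIN_span B. k i < Min a \<longrightarrow> a \<in> S i" by metis
  then show ?thesis using that[of B k] B(1,2) by blast
qed

text \<open>For blocks \<open>s < t\<close>, the count \<open>r\<close> of elements followed by an \<open>f\<close>-large gap satisfies
  \<open>r (s \<union> t) = r s + r t\<close>, minus one if the gap between \<open>s\<close> and \<open>t\<close> is small. If \<open>r\<close> has constant
  parity on a span, then all gaps there are of one kind, and they cannot all be small.\<close>

lemma U_sparse:
  fixes f :: "nat \<Rightarrow> nat"
  assumes S: "S \<in> \<U>"
  obtains A where "A \<in> FIN_block_seqs" "FIN_span A \<in> \<U>" "FIN_span A \<subseteq> S"
    "\<And>j. f (Max (A j)) < Min (A (Suc j))"
proof -
  define Q where "Q s = {x \<in> s. \<forall>y\<in>s. x < y \<longrightarrow> f x < y}" for s :: "nat set"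
  have card_Q: "card (Q (s \<union> t)) + (if f (Max s) < Min t then 0 else 1) = card (Q s) + card (Q t)"
    if s: "finite s" "s \<noteq> {}" and t: "finite t" "t \<noteq> {}" and st: "Max s < Min t" for s t
  proof -
    have lt: "x < y" if "x \<in> s" "y \<in> t" for x y
      using that s t st by (meson Max_ge Min_le le_less_trans less_le_trans)
    have finQ: "finite (Q s)" "finite (Q t)" using s t by (auto simp: Q_def)
    have dis: "Q s \<inter> Q t = {}" using lt by (fastforce simp: Q_def)
    have M: "Max s \<in> Q s" using s by (auto simp: Q_def leD)
    have t_part: "x \<in> Q (s \<union> t) \<longleftrightarrow> x \<in> Q t" if "x \<in> t" for x
      using that lt by (fastforce simp: Q_def)
    \<comment> \<open>An element of \<open>Q s\<close> below \<open>Max s\<close> already has its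
      next gap inside \<open>s\<close>, so adding \<open>t\<close> changes nothing. Only
      \<open>Max s\<close>, which is in \<open>Q s\<close> vacuously, can drop out.\<close>
    have s_part: "x \<in> Q (s \<union> t) \<longleftrightarrow> x \<in> Q s" if "x \<in> s" "x \<noteq> Max s" for x
    proof -
      have "x < Max s" using that s by (simp add: less_le)
      then have "f x < y" if "x \<in> Q s" "y \<in> t" for y
      proof -
        have "Max s \<in> s" using s by simp
        then have "f x < Max s" using \<open>x < Max s\<close> that(1) by (auto simp: Q_def)
        then show ?thesis using lt[OF \<open>Max s \<in> s\<close> that(2)] by simp
      qed
      then show ?thesis using that(1) by (auto simp: Q_def)
    qed
    have M_part: "Max s \<in> Q (s \<union> t) \<longleftrightarrow> f (Max s) < Min t"
      using s t lt by (auto simp: Q_def leD)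
    have sub: "Q (s \<union> t) \<subseteq> s \<union> t" "Q s \<subseteq> s" "Q t \<subseteq> t" by (auto simp: Q_def)
    show ?thesis
    proof (cases "f (Max s) < Min t")
      case True
      have "Q (s \<union> t) = Q s \<union> Q t"
      proof (rule set_eqI)
        fix x show "x \<in> Q (s \<union> t) \<longleftrightarrow> x \<in> Q s \<union> Q t"
          using t_part[of x] s_part[of x] M_part M True sub lt[of x x]
          by (cases "x = Max s"; cases "x \<in> s"; cases "x \<in> t") auto
      qed
      then show ?thesis using True finQ dis by (simp add: card_Un_disjoint)
    next
      case False
      have "Q (s \<union> t) = (Q s - {Max s}) \<union> Q t"
      proof (rule set_eqI)
        fix x show "x \<in> Q (s \<union> t) \<longleftrightarrow> x \<in> (Q s - {Max s}) \<union> Q t"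
          using t_part[of x] s_part[of x] M_part M False sub lt[of x x]
          by (cases "x = Max s"; cases "x \<in> s"; cases "x \<in> t") auto
      qed
      moreover have "(Q s - {Max s}) \<inter> Q t = {}" using dis by blast
      ultimately have "card (Q (s \<union> t)) = card (Q s - {Max s}) + card (Q t)"
        using finQ by (simp add: card_Un_disjoint)
      moreover have "card (Q s - {Max s}) + 1 = card (Q s)"
        using M finQ by (metis Suc_eq_plus1 card_Suc_Diff1)
      ultimately show ?thesis using False by simp
    qed
  qed
  define P where "P = {a \<in> FIN. even (card (Q a))}"
  have "P \<in> \<U> \<or> FIN - P \<in> \<U>" by (rule U_ultra) (auto simp: P_def)
  then obtain C where C: "C \<in> \<U>" "C = P \<or> C = FIN - P" by blast
  obtain A where A: "A \<in> FIN_block_seqs" "FIN_span A \<in> \<U>" "FIN_span A \<subseteq> S \<inter> C"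
    using U_base[OF U_Int[OF S C(1)]] by blast
  have parity: "even (card (Q a)) \<longleftrightarrow> C = P" if "a \<in> FIN_span A" for a
    using that A(2,3) C(2) U_FIN[OF A(2)] by (auto simp: P_def)
  have gap: "f (Max (A i)) < Min (A j) \<longleftrightarrow> C = P" if "i < j" for i j
  proof -
    have "A i \<union> A j \<in> FIN_span A" using FIN_spanI[of "{i, j}" A] by simp
    with parity FIN_span_base[of A]
      card_Q[of "A i" "A j"] FIN_block_memD[OF A(1)] FIN_block_less[OF A(1) that]
    have "even (card (Q (A i \<union> A j))) \<longleftrightarrow> C = P" "even (card (Q (A i))) \<longleftrightarrow> C = P"
      "even (card (Q (A j))) \<longleftrightarrow> C = P"
      "card (Q (A i \<union> A j)) + (if f (Max (A i)) < Min (A j) then 0 else 1)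
        = card (Q (A i)) + card (Q (A j))" by auto
    \<comment> \<open>If all three counts are even, the correction term must be 0; if all three are
      odd, it must be 1.\<close>
    then show ?thesis by (smt (verit) even_add odd_one even_zero)
  qed
  \<comment> \<open>Block \<open>j\<close> starts at \<open>j\<close> or later, so a block of index
    above \<open>f (Max (A 0))\<close> leaves a large gap after block 0.\<close>
  have "f (Max (A 0)) < Min (A (Suc (f (Max (A 0)))))"
    using FIN_block_ge[OF A(1), of "Suc (f (Max (A 0)))"] by simp
  then have "C = P" using gap[of 0 "Suc (f (Max (A 0)))"] by simp
  then have "f (Max (A j)) < Min (A (Suc j))" for j using gap[of j "Suc j"] by simp
  then show ?thesis using that[of A] A by blast
qed

end

section \<open>Infinite-dimensional subspaces and block sequences\<close>

context vector_space
begin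

text \<open>\<open>W \<inter> V\<close> has codimension at most one in \<open>W\<close>: one vector
  \<open>w\<close> of \<open>W\<close> outside \<open>V\<close>, added to a finite spanning set of
  \<open>W \<inter> V\<close>, would span \<open>W\<close>.\<close>

lemma infinite_dim_Int_hyperplane:
  assumes W: "infinite_dim_subspace W" and V: "subspace V" and sub: "W \<subseteq> span (insert b V)"
  shows "infinite_dim_subspace (W \<inter> V)"
proof (cases "W \<subseteq> V")
  case True
  then show ?thesis using W by (simp add: Int_absorb2)
next
  case False
  have sW: "subspace W" using W by (simp add: infinite_dim_subspace_def)
  have span_V: "span V = V" using V by (simp add: span_eq_iff)
  from False obtain w where w: "w \<in> W" "w \<notin> V" by blast
  obtain c where c: "w - c *s b \<in> V"
    using w(1) sub span_V span_breakdown_eq[of w b V] by blast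
  have c0: "c \<noteq> 0" using c w by auto
  have "\<not> (\<exists>C. finite C \<and> C \<subseteq> W \<inter> V \<and> span C = W \<inter> V)"
  proof
    assume "\<exists>C. finite C \<and> C \<subseteq> W \<inter> V \<and> span C = W \<inter> V"
    then obtain C where C: "finite C" "C \<subseteq> W \<inter> V" "span C = W \<inter> V" by blast
    have "W \<subseteq> span (insert w C)"
    proof
      fix v assume v: "v \<in> W"
      obtain d where d: "v - d *s b \<in> V"
        using v sub span_V span_breakdown_eq[of v b V] by blast
      \<comment> \<open>This multiple of \<open>w\<close> cancels the \<open>b\<close>-component of
        \<open>v\<close> modulo \<open>V\<close>.\<close>
      have "v - (d / c) *s w = (v - d *s b) - (d / c) *s (w - c *s b)"
        using c0 by (simp add: scale_right_diff_distrib)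
      also have "\<dots> \<in> V" using subspace_diff[OF V d subspace_scale[OF V c]] .
      finally have "v - (d / c) *s w \<in> W \<inter> V"
        using subspace_diff[OF sW v subspace_scale[OF sW w(1)]] by simp
      then show "v \<in> span (insert w C)" using C(3) by (auto simp: span_breakdown_eq)
    qed
    moreover have "span (insert w C) \<subseteq> W" using w C sW by (intro span_minimal) auto
    ultimately show False using W w C unfolding infinite_dim_subspace_def
      by (metis Int_subset_iff finite_insert insert_subset subset_antisym)
  qed
  then show ?thesis using sW V by (auto simp: infinite_dim_subspace_def subspace_inter)
qed

text \<open>Induction on the number of vectors completing \<open>V\<close>: first enlarge
  \<open>V\<close> by \<open>b\<close>, then cut back to \<open>V\<close> by the hyperplane
  case.\<close>

lemma infinite_dim_Int_finite_codim:
  assumes W: "infinite_dim_subspace W" and V: "finite_codim_subspace V"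
  shows "infinite_dim_subspace (W \<inter> V)"
proof -
  obtain B where B: "finite B" "span (V \<union> B) = UNIV" and sV: "subspace V"
    using V by (auto simp: finite_codim_subspace_def)
  from B sV show ?thesis
  proof (induction B arbitrary: V rule: finite_induct)
    case empty
    then have "V = UNIV" by (simp add: span_eq_iff[THEN iffD2])
    then show ?case using W by simp
  next
    case (insert b B)
    let ?V1 = "span (insert b V)"
    have "V \<union> insert b B \<subseteq> span (?V1 \<union> B)"
      by (auto intro!: span_base) 
    then have "span (V \<union> insert b B) \<subseteq> span (?V1 \<union> B)"
      by (intro span_minimal) auto
    then have "infinite_dim_subspace (W \<inter> ?V1)"
      using insert.prems by (intro insert.IH) auto
    from infinite_dim_Int_hyperplane[OF this insert.prems(2), of b]
    have "infinite_dim_subspace (W \<inter> ?V1 \<inter> V)" by blast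
    moreover have "W \<inter> ?V1 \<inter> V = W \<inter> V" by (auto intro: span_base)
    ultimately show ?case by simp
  qed
qed

lemma infinite_dim_nonzero:
  assumes "infinite_dim_subspace V" obtains v where "v \<in> V" "v \<noteq> 0"
proof -
  have "V \<noteq> {0}"
  proof
    assume "V = {0}"
    then have "finite {} \<and> {} \<subseteq> V \<and> span {} = V" by simp
    then show False using assms unfolding infinite_dim_subspace_def by blast
  qed
  moreover have "0 \<in> V" using assms by (auto simp: infinite_dim_subspace_def subspace_0)
  ultimately show ?thesis using that by auto
qed

lemma span_range_finite_sum:
  fixes X :: "nat \<Rightarrow> 'b"
  assumes "v \<in> span (range X)"
  obtains n c where "v = (\<Sum>i<n. c i *s X i)"
proof -
  have "\<exists>n c. v = (\<Sum>i<n. c i *s X i)"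
    using assms
  proof (induction rule: span_induct_alt)
    case base
    have "0 = (\<Sum>i<(0::nat). (\<lambda>_. 0) i *s X i)" by simp
    then show ?case by (intro exI)
  next
    case (step a x y)
    then obtain k n c where k: "x = X k" "y = (\<Sum>i<n. c i *s X i)" by auto
    let ?N = "max n (Suc k)"
    have "(\<Sum>i<?N. (if i < n then c i else 0) *s X i) = (\<Sum>i<n. c i *s X i)"
      by (rule sum.mono_neutral_cong_right) auto
    moreover have "(\<Sum>i<?N. (if i = k then a else 0) *s X i) = a *s X k"
    proof -
      have "(\<Sum>i<?N. (if i = k then a else 0) *s X i) = (\<Sum>i\<in>{k}. a *s X i)"
        by (rule sum.mono_neutral_cong_right) auto
      then show ?thesis by simp
    qed
    ultimately have "a *s x + y =
      (\<Sum>i<?N. (\<lambda>i. (if i = k then a else 0) + (if i < n then c i else 0)) i *s X i)"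
      by (simp add: k scale_left_distrib sum.distrib)
    then show ?case by (intro exI)
  qed
  then show ?thesis using that by blast
qed

end

section \<open>Coordinates, supports and block sequences of vectors\<close>

context based_vector_space
begin

notation scale (infixr \<open>*s\<close> 75)

abbreviation coef :: "'b \<Rightarrow> nat \<Rightarrow> 'a" where
  "coef v i \<equiv> representation (range e) v (e i)"

lemma in_span_basis: "v \<in> span (range e)"
  by (simp add: span_basis)

lemma coef_add: "coef (u + v) i = coef u i + coef v i"
  by (simp add: representation_add[OF independent_basis in_span_basis in_span_basis])

lemma coef_scale: "coef (c *s v) i = c * coef v i"
  by (simp add: representation_scale[OF independent_basis in_span_basis])

lemma coef_sum: "coef (\<Sum>j\<in>J. f j) i = (\<Sum>j\<in>J. coef (f j) i)"
  by (simp add: representation_sum[OF independent_basis in_span_basis])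

lemma coef_basis: "coef (e j) i = (if i = j then 1 else 0)"
  using inj_basis by (simp add: representation_basis[OF independent_basis] inj_eq)

lemma supp_zero [simp]: "supp 0 = {}"
  by (simp add: supp_def representation_zero)

lemma finite_supp [simp]: "finite (supp v)"
proof -
  have "supp v = e -` {b. representation (range e) v b \<noteq> 0}" by (auto simp: supp_def)
  then show ?thesis using finite_vimageI[OF finite_representation inj_basis] by simp
qed

lemma supp_expansion: "v = (\<Sum>i\<in>supp v. coef v i *s e i)"
proof -
  have "{b. representation (range e) v b \<noteq> 0} = e ` supp v"
    using representation_ne_zero[of "range e" v] by (auto simp: supp_def)
  then have "(\<Sum>b\<in>e ` supp v. representation (range e) v b *s b) = v"
    using sum_nonzero_representation_eq[OF independent_basis in_span_basis, of v] by simp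
  moreover have "inj_on e (supp v)" using inj_basis by (meson inj_on_subset subset_UNIV)
  ultimately show ?thesis by (simp add: sum.reindex)
qed

lemma supp_eq_empty_iff [simp]: "supp v = {} \<longleftrightarrow> v = 0"
proof
  assume "supp v = {}"
  then have "(\<Sum>i\<in>supp v. coef v i *s e i) = 0" by simp
  with supp_expansion[of v] show "v = 0" by (rule trans)
qed simp

lemma supp_in_FIN_iff: "supp v \<in> FIN \<longleftrightarrow> v \<noteq> 0"
  by (simp add: FIN_def)

text \<open>Countability lets stability act on families of members of \<U> indexed by vectors or by
  finite sets of vectors.\<close>

lemma countable_vectors: "countable (UNIV :: 'b set)"
proof -
  let ?L = "\<lambda>xs. \<Sum>(c, i)\<leftarrow>xs. c *s e i"
  have "countable (UNIV :: ('a \<times> nat) list set)"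
    using countable_field by (metis countableI_type countable_SIGMA countable_lists lists_UNIV UNIV_Times_UNIV)
  moreover have "v \<in> range ?L" for v
  proof -
    obtain l where l: "set l = supp v" "distinct l" using finite_distinct_list[OF finite_supp] by blast
    have "?L (map (\<lambda>i. (coef v i, i)) l) = (\<Sum>i\<in>supp v. coef v i *s e i)"
      using l by (simp add: o_def sum_list_distinct_conv_sum_set)
    then have "v = ?L (map (\<lambda>i. (coef v i, i)) l)" by (simp only: supp_expansion[symmetric])
    then show ?thesis by (rule range_eqI)
  qed
  ultimately have "countable (range ?L)" "UNIV \<subseteq> range ?L" by auto
  then show ?thesis using countable_subset by blast
qed

lemma infinite_vectors: "infinite (UNIV :: 'b set)"
  by (rule infinite_super[OF subset_UNIV range_inj_infinite[OF inj_basis]])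

text \<open>Hence every infinite-dimensional subspace stays infinite-dimensional when cut down to
  the vectors supported above \<open>k\<close>.\<close>

lemma finite_codim_coords_gt: "finite_codim_subspace {v. supp v \<inter> {..k} = {}}"
proof -
  let ?V = "{v. supp v \<inter> {..k} = {}}"
  have "subspace ?V"
    unfolding subspace_def
    by (auto simp: supp_def coef_add coef_scale representation_zero disjoint_iff) (metis add_0)
  moreover have "span (?V \<union> e ` {..k}) = UNIV"
  proof -
    have "e i \<in> span (?V \<union> e ` {..k})" for i
    proof (cases "i \<le> k")
      case False
      then have "e i \<in> ?V" by (auto simp: supp_def coef_basis)
      then show ?thesis by (intro span_base) auto
    qed (auto intro!: span_base)
    then have "span (range e) \<subseteq> span (?V \<union> e ` {..k})" by (intro span_minimal) auto
    then show ?thesis by (auto simp: span_basis)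
  qed
  ultimately show ?thesis unfolding finite_codim_subspace_def by blast
qed

lemma block_supp: "X \<in> block_seqs \<longleftrightarrow> (\<lambda>n. supp (X n)) \<in> FIN_block_seqs"
  by (auto simp: block_seqs_def FIN_block_seqs_def FIN_def)

text \<open>Each coordinate lies in the support of at most one block, so nothing cancels.\<close>

lemma supp_block_sum:
  assumes X: "X \<in> block_seqs" and I: "finite I"
  shows "supp (\<Sum>i\<in>I. c i *s X i) = (\<Union>i\<in>{i\<in>I. c i \<noteq> 0}. supp (X i))"
proof (rule set_eqI)
  fix n
  have uniq: "i = j" if "n \<in> supp (X i)" "n \<in> supp (X j)" for i j
    using FIN_block_disjoint[OF X[unfolded block_supp]] that by blast
  have coef: "coef (\<Sum>i\<in>I. c i *s X i) n = (\<Sum>i\<in>I. c i * coef (X i) n)"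
    by (simp add: coef_sum coef_scale)
  show "n \<in> supp (\<Sum>i\<in>I. c i *s X i) \<longleftrightarrow> n \<in> (\<Union>i\<in>{i\<in>I. c i \<noteq> 0}. supp (X i))"
  proof (cases "\<exists>i\<in>I. n \<in> supp (X i)")
    case True
    then obtain j where j: "j \<in> I" "n \<in> supp (X j)" by blast
    have "(\<Sum>i\<in>I. c i * coef (X i) n) = (\<Sum>i\<in>{j}. c i * coef (X i) n)"
      using j I uniq by (intro sum.mono_neutral_right) (auto simp: supp_def)
    then have "n \<in> supp (\<Sum>i\<in>I. c i *s X i) \<longleftrightarrow> c j \<noteq> 0"
      using coef j by (simp add: supp_def)
    then show ?thesis using j uniq by auto
  next
    case False
    then have "(\<Sum>i\<in>I. c i * coef (X i) n) = 0" by (intro sum.neutral) (auto simp: supp_def)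
    then show ?thesis using False coef by (auto simp: supp_def)
  qed
qed

lemma nz_span_block_sum:
  assumes X: "X \<in> block_seqs" and v: "v \<in> span (range X)"
  obtains I c where "finite I" "v = (\<Sum>i\<in>I. c i *s X i)" "supp v = (\<Union>i\<in>I. supp (X i))"
proof -
  obtain n c where v: "v = (\<Sum>i<n. c i *s X i)" using v by (rule span_range_finite_sum)
  let ?I = "{i\<in>{..<n}. c i \<noteq> 0}"
  have "v = (\<Sum>i\<in>?I. c i *s X i)" unfolding v by (rule sum.mono_neutral_right) auto
  moreover have "supp v = (\<Union>i\<in>?I. supp (X i))" unfolding v by (rule supp_block_sum[OF X]) simp
  ultimately show ?thesis using that[of ?I c] by simp
qed

text \<open>Zero coefficients are discarded in one direction, all coefficients are 1 in the other.
  This ties spans of vectors to the base of \<U>.\<close>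

lemma supp_nz_span:
  assumes X: "X \<in> block_seqs"
  shows "supp ` nz_span X = FIN_span (\<lambda>n. supp (X n))"
proof
  show "supp ` nz_span X \<subseteq> FIN_span (\<lambda>n. supp (X n))"
  proof
    fix a assume "a \<in> supp ` nz_span X"
    then obtain v where v: "v \<in> span (range X)" "v \<noteq> 0" "a = supp v" by (auto simp: nz_span_def)
    obtain I c where I: "finite I" "v = (\<Sum>i\<in>I. c i *s X i)" "supp v = (\<Union>i\<in>I. supp (X i))"
      using nz_span_block_sum[OF X v(1)] .
    have "I \<noteq> {}" using I v by auto
    then show "a \<in> FIN_span (\<lambda>n. supp (X n))" using I v by (auto intro!: FIN_spanI)
  qed
  show "FIN_span (\<lambda>n. supp (X n)) \<subseteq> supp ` nz_span X"
  proof
    fix a assume "a \<in> FIN_span (\<lambda>n. supp (X n))"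
    then obtain I where I: "finite I" "I \<noteq> {}" "a = (\<Union>i\<in>I. supp (X i))"
      by (auto simp: FIN_span_def)
    let ?v = "\<Sum>i\<in>I. 1 *s X i"
    have s: "supp ?v = a" using supp_block_sum[OF X I(1), of "\<lambda>_. 1"] I(3) by simp
    have "\<exists>i\<in>I. supp (X i) \<noteq> {}" using I(2) X by (auto simp: block_seqs_def)
    then have "?v \<noteq> 0" using s I(3) by (metis SUP_bot_conv(2) supp_zero)
    moreover have "?v \<in> span (range X)" by (intro span_sum span_scale span_base) auto
    ultimately show "a \<in> supp ` nz_span X" using s by (auto simp: nz_span_def)
  qed
qed

lemma block_shift: "X \<in> block_seqs \<Longrightarrow> (\<lambda>k. X (k + m)) \<in> block_seqs"
  by (auto simp: block_seqs_def)

lemma block_nonzero_span: "X \<in> block_seqs \<Longrightarrow> X n \<in> nz_span X"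
  by (auto simp: block_seqs_def nz_span_def intro: span_base)

lemma span_block_tail:
  assumes X: "X \<in> block_seqs" and v: "v \<in> span (range X)"
    and m: "v \<noteq> 0 \<Longrightarrow> Max (supp (X m)) < Min (supp v)"
  shows "v \<in> span (range (\<lambda>k. X (k + m)))"
proof -
  obtain I c where I: "finite I" "v = (\<Sum>i\<in>I. c i *s X i)" "supp v = (\<Union>i\<in>I. supp (X i))"
    using nz_span_block_sum[OF X v] .
  have F: "(\<lambda>n. supp (X n)) \<in> FIN_block_seqs" using X block_supp by blast
  have "X i \<in> range (\<lambda>k. X (k + m))" if i: "i \<in> I" for i
  proof -
    have ne: "supp (X i) \<noteq> {}" using FIN_block_memD[OF F] by blast
    then have "v \<noteq> 0" using I(3) i by auto
    have "m \<le> i"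
    proof (rule ccontr)
      assume "\<not> m \<le> i"
      then have "Max (supp (X i)) < Min (supp (X m))" using FIN_block_less[OF F, of i m] by simp
      moreover have "Min (supp (X m)) \<le> Max (supp (X m))" using FIN_block_memD[OF F] by simp
      moreover have "Min (supp v) \<le> Max (supp (X i))"
      proof (rule Min_le)
        have "Max (supp (X i)) \<in> supp (X i)" using ne by simp
        then show "Max (supp (X i)) \<in> supp v" using i I(3) by blast
      qed simp
      ultimately show False using m[OF \<open>v \<noteq> 0\<close>] by simp
    qed
    then show ?thesis using rangeI[of "\<lambda>k. X (k + m)" "i - m"] by simp
  qed
  then show ?thesis unfolding I(2) by (intro span_sum span_scale span_base)
qed

text \<open>A finite set uses only coordinates up to some \<open>k\<close>, and so does its span,
  whereas the support of \<open>X (Suc k)\<close> starts above \<open>k\<close>.\<close>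

lemma infinite_dim_span_block:
  assumes X: "X \<in> block_seqs" shows "infinite_dim_subspace (span (range X))"
proof -
  have F: "(\<lambda>n. supp (X n)) \<in> FIN_block_seqs" using X block_supp by blast
  have False if B: "finite B" "span B = span (range X)" for B
  proof -
    have "finite (\<Union>(supp ` B))" using B by simp
    then obtain k where k: "\<forall>n\<in>\<Union>(supp ` B). n \<le> k" using finite_nat_set_iff_bounded_le by blast
    let ?W = "{v. \<forall>n>k. coef v n = 0}"
    have "subspace ?W" unfolding subspace_def by (auto simp: coef_add coef_scale representation_zero)
    moreover have "B \<subseteq> ?W" using k by (fastforce simp: supp_def)
    ultimately have "span B \<subseteq> ?W" by (intro span_minimal)
    moreover have "X (Suc k) \<in> span B" using B(2) by (auto intro: span_base)
    ultimately have "\<forall>n\<in>supp (X (Suc k)). n \<le> k" 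
    proof -
      have "\<forall>n>k. coef (X (Suc k)) n = 0"
        using \<open>span B \<subseteq> ?W\<close> \<open>X (Suc k) \<in> span B\<close> by blast
      then show ?thesis unfolding supp_def using not_le by blast
    qed
    moreover have "Min (supp (X (Suc k))) \<in> supp (X (Suc k))"
      using FIN_block_memD[OF F] by (intro Min_in) auto
    moreover have "Suc k \<le> Min (supp (X (Suc k)))" by (rule FIN_block_ge[OF F])
    ultimately show False by fastforce
  qed
  then show ?thesis by (auto simp: infinite_dim_subspace_def)
qed

end

section \<open>The dichotomy\<close>

locale supported_space = based_vector_space scale e + stable_ou \<U>
  for scale :: "'a :: field \<Rightarrow> 'b :: ab_group_add \<Rightarrow> 'b" and e :: "nat \<Rightarrow> 'b" and \<U>
begin

definition good :: "(nat \<Rightarrow> 'b) \<Rightarrow> bool" where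
  "good X \<longleftrightarrow> X \<in> block_seqs \<and> supp ` nz_span X \<in> \<U>"

text \<open>Inclusion modulo finite with the tail cut at an index rather than at a bound on
  supports, which suits the recursion; it is converted to \<open>block_almost_le\<close> at the
  end.\<close>

definition eventually_in_span :: "(nat \<Rightarrow> 'b) \<Rightarrow> (nat \<Rightarrow> 'b) \<Rightarrow> bool" where
  "eventually_in_span Y X \<longleftrightarrow> (\<exists>m. \<forall>j\<ge>m. Y j \<in> span (range X))"

definition decides :: "'b set \<Rightarrow> (nat \<Rightarrow> 'b) \<Rightarrow> bool" where
  "decides D X \<longleftrightarrow> nz_span X \<subseteq> D \<or>
     (\<forall>V. infinite_dim_subspace V \<longrightarrow> V \<subseteq> span (range X) \<longrightarrow> \<not> V - {0} \<subseteq> D)"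

definition spoiled :: "(nat \<Rightarrow> 'b) \<Rightarrow> 'b set \<Rightarrow> 'b set \<Rightarrow> bool" where
  "spoiled X D B \<longleftrightarrow> (\<exists>S\<in>\<U>. \<forall>V. infinite_dim_subspace V \<longrightarrow> V \<subseteq> span (range X) \<longrightarrow>
     supp ` (V - {0}) \<subseteq> S \<longrightarrow> \<not> span (B \<union> V) - {0} \<subseteq> D)"

section \<open>Good block sequences: refinements and pseudointersections\<close>

lemma supp_image_FIN: "0 \<notin> G \<Longrightarrow> supp ` G \<subseteq> FIN"
  using supp_in_FIN_iff by auto

text \<open>Goodness depends on supports alone. So one may first find the blocks in \<U> and then
  choose any vectors carried by them.\<close>

lemma good_of_supports:
  assumes "A \<in> FIN_block_seqs" "FIN_span A \<in> \<U>" "\<And>j. supp (Y j) = A j"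
  shows "good Y" "supp ` nz_span Y = FIN_span A"
proof -
  have eq: "(\<lambda>j. supp (Y j)) = A" using assms(3) by auto
  then have "Y \<in> block_seqs" using assms(1) by (simp add: block_supp)
  then show "supp ` nz_span Y = FIN_span A" using supp_nz_span eq by simp
  with \<open>Y \<in> block_seqs\<close> assms(2) show "good Y" by (simp add: good_def)
qed

lemma good_basis: "good e"
proof (rule good_def[THEN iffD2], rule conjI)
  have s: "supp (e i) = {i}" for i by (auto simp: supp_def coef_basis)
  then show b: "e \<in> block_seqs" by (simp add: block_supp FIN_block_seqs_def FIN_def)
  have "a \<in> FIN_span (\<lambda>i. {i})" if "a \<in> FIN" for a
    using that FIN_spanI[of a "\<lambda>i. {i}"] by (simp add: FIN_def)
  then have "FIN_span (\<lambda>i. {i}) = FIN" by (auto simp: FIN_span_def FIN_def)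
  then show "supp ` nz_span e \<in> \<U>" using supp_nz_span[OF b] s FIN_in_U by simp
qed

lemma ex_vector_supp:
  assumes "a \<in> FIN" obtains v where "supp v = a"
proof -
  have "supp (\<Sum>i\<in>a. 1 *s e i) = (\<Union>i\<in>a. supp (e i))"
    using supp_block_sum[of e a "\<lambda>_. 1"] good_basis assms by (simp add: good_def FIN_def)
  also have "\<dots> = a" by (auto simp: supp_def coef_basis)
  finally show ?thesis by (rule that)
qed

text \<open>Sets in the span that start beyond the minimum of block \<open>m\<close> avoid the first
  \<open>m\<close> blocks, and by \<open>U_tail\<close> these are \<U>-many.\<close>

lemma good_shift:
  assumes "good X" shows "good (\<lambda>k. X (k + m))"
proof -
  have X: "X \<in> block_seqs" and XU: "supp ` nz_span X \<in> \<U>" using assms by (auto simp: good_def)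
  let ?A = "\<lambda>n. supp (X n)"
  have F: "?A \<in> FIN_block_seqs" using X block_supp by blast
  have sh: "supp ` nz_span (\<lambda>k. X (k + m)) = FIN_span (\<lambda>k. ?A (k + m))"
    using supp_nz_span[OF block_shift[OF X]] by simp
  have "FIN_span ?A \<inter> {a \<in> FIN. Min (?A m) < Min a} \<subseteq> FIN_span (\<lambda>k. ?A (k + m))"
  proof
    fix a assume a: "a \<in> FIN_span ?A \<inter> {a \<in> FIN. Min (?A m) < Min a}"
    show "a \<in> FIN_span (\<lambda>k. ?A (k + m))"
    proof (rule FIN_span_shift[OF F])
      fix i assume "i < m"
      then have "Max (?A i) < Min (?A m)" by (rule FIN_block_less[OF F])
      moreover have "Min (?A i) \<le> Max (?A i)" using FIN_block_memD[OF F, of i] by simp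
      ultimately show "Min (?A i) < Min a" using a by simp
    qed (use a in simp)
  qed
  moreover have "FIN_span ?A \<inter> {a \<in> FIN. Min (?A m) < Min a} \<in> \<U>"
    using XU supp_nz_span[OF X] U_tail by (intro U_Int) auto
  moreover have "FIN_span (\<lambda>k. ?A (k + m)) \<subseteq> FIN"
    unfolding sh[symmetric] by (rule supp_image_FIN) (simp add: nz_span_def)
  ultimately have "FIN_span (\<lambda>k. ?A (k + m)) \<in> \<U>" using U_mono by blast
  then show ?thesis using sh block_shift[OF X] by (simp add: good_def)
qed

lemma good_refine:
  assumes "good X" "S \<in> \<U>"
  obtains Z where "good Z" "span (range Z) \<subseteq> span (range X)" "supp ` nz_span Z \<subseteq> S"
proof -
  have "S \<inter> supp ` nz_span X \<in> \<U>" using assms U_Int by (auto simp: good_def)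
  then obtain A where A: "A \<in> FIN_block_seqs" "FIN_span A \<in> \<U>" "FIN_span A \<subseteq> S \<inter> supp ` nz_span X"
    by (rule U_base)
  have "A j \<in> supp ` nz_span X" for j using A(3) FIN_span_base[of A j] by blast
  then have "\<exists>z. z \<in> nz_span X \<and> supp z = A j" for j by (metis imageE)
  then obtain Z where Z: "\<And>j. Z j \<in> nz_span X" "\<And>j. supp (Z j) = A j" by metis
  have "span (range Z) \<subseteq> span (range X)"
    using Z(1) by (intro span_minimal) (auto simp: nz_span_def)
  with good_of_supports[OF A(1,2) Z(2)] A(3) show ?thesis by (intro that[of Z]) auto
qed

text \<open>Stability controls only supports, so the vectors remain to be chosen: on block
  \<open>j\<close>, take one from \<open>G n\<close> for the largest \<open>n\<close> whose
  threshold the block has passed. As \<open>G\<close> decreases, it serves all smaller indices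
  too.\<close>

lemma good_pseudointersection:
  fixes G :: "nat \<Rightarrow> 'b set"
  assumes G: "\<And>n. supp ` G n \<in> \<U>" and dec: "\<And>m n. m \<le> n \<Longrightarrow> G n \<subseteq> G m"
  obtains Y where "good Y" "\<And>n. \<exists>m. \<forall>j\<ge>m. Y j \<in> G n"
proof -
  obtain B k where B: "B \<in> FIN_block_seqs" "FIN_span B \<in> \<U>"
    and k: "\<And>n a. a \<in> FIN_span B \<Longrightarrow> k n < Min a \<Longrightarrow> a \<in> supp ` G n"
    using U_pseudointersection[of "UNIV :: nat set" "\<lambda>n. supp ` G n"] G by auto
  \<comment> \<open>The restriction \<open>n \<le> j\<close> leaves finitely many candidates, so a
    largest exists. With no candidate, any vector of support \<open>B j\<close> will do.\<close>
  have "\<exists>y. supp y = B j \<and> (\<forall>n\<le>j. k n < Min (B j) \<longrightarrow> y \<in> G n)" for j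
  proof (cases "\<exists>n\<le>j. k n < Min (B j)")
    case True
    let ?N = "{n. n \<le> j \<and> k n < Min (B j)}"
    have N: "finite ?N" "?N \<noteq> {}" using True by auto
    then have "Max ?N \<in> ?N" by (rule Max_in)
    then obtain y where y: "y \<in> G (Max ?N)" "supp y = B j"
      using k[OF FIN_span_base[of B j], of "Max ?N"] by auto
    have "y \<in> G n" if "n \<in> ?N" for n using dec[OF Max_ge[OF N(1) that]] y by blast
    then show ?thesis using y(2) by blast
  next
    case False
    have "B j \<in> FIN" using B(1) by (simp add: FIN_block_seqs_def)
    then show ?thesis using False ex_vector_supp by metis
  qed
  then obtain Y where Y: "\<And>j. supp (Y j) = B j" "\<And>j n. n \<le> j \<Longrightarrow> k n < Min (B j) \<Longrightarrow> Y j \<in> G n"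
    by metis
  have "\<forall>j\<ge>max n (Suc (k n)). Y j \<in> G n" for n
  proof (intro allI impI Y(2))
    fix j assume "max n (Suc (k n)) \<le> j"
    then show "n \<le> j" "k n < Min (B j)" using FIN_block_ge[OF B(1), of j] by simp_all
  qed
  then show ?thesis using that[OF good_of_supports(1)[OF B Y(1)]] by blast
qed

section \<open>Spoiled sets and the decision of a set of vectors\<close>

lemma not_spoiled_subset: "\<not> spoiled X D B \<Longrightarrow> span B - {0} \<subseteq> D"
proof (rule ccontr)
  assume "\<not> spoiled X D B" "\<not> span B - {0} \<subseteq> D"
  moreover have "span B \<subseteq> span (B \<union> V)" for V by (rule span_mono) blast
  \<comment> \<open>With \<open>FIN\<close> in the role of \<open>S\<close>, some \<open>V\<close>
    has \<open>span (B \<union> V) - {0} \<subseteq> D\<close>, and the span of \<open>B\<close>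
    lies inside.\<close>
  ultimately show False using FIN_in_U unfolding spoiled_def by blast
qed

text \<open>Otherwise \<U>-many supports belong only to vectors \<open>y\<close> that spoil
  \<open>B\<close> when added. A pseudointersection of the countably many witnesses for this,
  restricted to those supports, would witness that \<open>B\<close> itself is spoiled.\<close>

lemma not_spoiled_step:
  assumes X: "good X" and B: "\<not> spoiled X D B"
  shows "supp ` {y \<in> nz_span X. \<not> spoiled X D (insert y B)} \<in> \<U>" (is "?W \<in> \<U>")
proof (rule ccontr)
  assume "?W \<notin> \<U>"
  moreover have "?W \<subseteq> FIN" by (rule supp_image_FIN) (simp add: nz_span_def)
  ultimately have T: "FIN - ?W \<in> \<U>" using U_ultra by blast
  let ?I = "{y. spoiled X D (insert y B)}"
  have "\<forall>y\<in>?I. \<exists>S\<in>\<U>. \<forall>V. infinite_dim_subspace V \<longrightarrow> V \<subseteq> span (range X) \<longrightarrow>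
     supp ` (V - {0}) \<subseteq> S \<longrightarrow> \<not> span (insert y B \<union> V) - {0} \<subseteq> D"
    unfolding spoiled_def by blast
  then obtain S where S: "\<And>y. y \<in> ?I \<Longrightarrow> S y \<in> \<U>"
    "\<And>y V. y \<in> ?I \<Longrightarrow> infinite_dim_subspace V \<Longrightarrow> V \<subseteq> span (range X) \<Longrightarrow>
     supp ` (V - {0}) \<subseteq> S y \<Longrightarrow> \<not> span (insert y B \<union> V) - {0} \<subseteq> D"
    by metis
  have "countable ?I" by (rule countable_subset[OF subset_UNIV countable_vectors])
  then obtain A k where A: "A \<in> FIN_block_seqs" "FIN_span A \<in> \<U>"
    and k: "\<And>y a. y \<in> ?I \<Longrightarrow> a \<in> FIN_span A \<Longrightarrow> k y < Min a \<Longrightarrow> a \<in> S y"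
    using U_pseudointersection[of ?I S] S(1) by metis
  have "\<not> span (B \<union> V) - {0} \<subseteq> D" if V: "infinite_dim_subspace V" "V \<subseteq> span (range X)"
    "supp ` (V - {0}) \<subseteq> FIN_span A \<inter> (FIN - ?W)" for V
  proof -
    \<comment> \<open>Any nonzero \<open>z\<close> in \<open>V\<close> works: its support lies
      outside \<open>?W\<close>, so \<open>insert z B\<close> is spoiled. Cutting \<open>V\<close>
      above \<open>k z\<close> brings its supports into \<open>S z\<close>.\<close>
    obtain z where z: "z \<in> V" "z \<noteq> 0" using infinite_dim_nonzero[OF V(1)] .
    have zI: "z \<in> ?I" using z V(2,3) by (auto simp: nz_span_def)
    let ?V = "V \<inter> {v. supp v \<inter> {..k z} = {}}"
    have "supp ` (?V - {0}) \<subseteq> S z"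
    proof
      fix a assume "a \<in> supp ` (?V - {0})"
      then obtain v where v: "v \<in> V" "v \<noteq> 0" "supp v \<inter> {..k z} = {}" "a = supp v" by auto
      have "Min a \<in> a" unfolding v(4) using v(2) by (intro Min_in) auto
      then have "k z < Min a" using v(3,4) not_le by blast
      moreover have "a \<in> FIN_span A" using v V(3) by blast
      ultimately show "a \<in> S z" using k zI by blast
    qed
    then have "\<not> span (insert z B \<union> ?V) - {0} \<subseteq> D"
      using V(2) by (intro S(2)[OF zI] infinite_dim_Int_finite_codim[OF V(1)] finite_codim_coords_gt) auto
    moreover have "span (insert z B \<union> ?V) \<subseteq> span (B \<union> V)"
      using z(1) by (intro span_mono) auto
    ultimately show ?thesis by blast
  qed
  then show False using B U_Int[OF A(2) T] unfolding spoiled_def by blast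
qed

text \<open>The vectors of \<open>Y\<close> are picked one at a time so that no finite initial part
  is spoiled; \<open>not_spoiled_subset\<close> then puts every finite combination in
  \<open>D\<close>. The difficulty is that the threshold for the next block depends on the vectors
  already picked.\<close>

lemma not_spoiled_subspace:
  assumes X: "good X" and empty: "\<not> spoiled X D {}"
  obtains Y where "good Y" "span (range Y) \<subseteq> span (range X)" "nz_span Y \<subseteq> D"
proof -
  define W where "W B = supp ` {y \<in> nz_span X. \<not> spoiled X D (insert y B)}" for B
  define I where "I = {B. finite B \<and> \<not> spoiled X D B}"
  have "countable I"
    unfolding I_def
    by (rule countable_subset[OF _ countable_Collect_finite_subset[OF countable_vectors]]) auto
  moreover have "\<And>B. B \<in> I \<Longrightarrow> W B \<in> \<U>"
    unfolding W_def I_def using not_spoiled_step[OF X] by blast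
  ultimately obtain C k where C: "C \<in> FIN_block_seqs" "FIN_span C \<in> \<U>"
    and k_I: "\<And>B a. B \<in> I \<Longrightarrow> a \<in> FIN_span C \<Longrightarrow> k B < Min a \<Longrightarrow> a \<in> W B"
    using U_pseudointersection[of I W] by metis
  have k: "a \<in> W B" if "finite B" "\<not> spoiled X D B" "a \<in> FIN_span C" "k B < Min a" for B a
    using k_I[of B a] that by (simp add: I_def)
  \<comment> \<open>A fixed choice function makes the picked vectors depend on the blocks alone, so
    bounded blocks allow only finitely many outcomes.\<close>
  define pick where "pick B a = (SOME y. y \<in> nz_span X \<and> supp y = a \<and> \<not> spoiled X D (insert y B))" for B a
  have pick: "pick B a \<in> nz_span X" "supp (pick B a) = a" "\<not> spoiled X D (insert (pick B a) B)"
    if "a \<in> W B" for B a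
  proof -
    have "\<exists>y. y \<in> nz_span X \<and> supp y = a \<and> \<not> spoiled X D (insert y B)"
      using that by (auto simp: W_def)
    from someI_ex[OF this] show "pick B a \<in> nz_span X" "supp (pick B a) = a"
      "\<not> spoiled X D (insert (pick B a) B)" by (auto simp: pick_def)
  qed
  \<comment> \<open>\<open>st m\<close> contains every set of vectors that can have been picked for blocks below \<open>m\<close>.\<close>
  define st where "st = rec_nat {{}} (\<lambda>m R. R \<union> (\<lambda>(B, a). insert (pick B a) B) ` (R \<times> Pow {..m}))"
  have st_0: "st 0 = {{}}"
    and st_Suc: "st (Suc m) = st m \<union> (\<lambda>(B, a). insert (pick B a) B) ` (st m \<times> Pow {..m})" for m
    by (simp_all add: st_def)
  have fin_st: "finite (st m)" for m by (induction m) (auto simp: st_0 st_Suc)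
  have st_mono: "st m \<subseteq> st n" if "m \<le> n" for m n
    using that by (rule lift_Suc_mono_le[rotated]) (auto simp: st_Suc)
  have st_step: "insert (pick B a) B \<in> st (Suc m)" if "B \<in> st m" "a \<subseteq> {..m}" for B a m
    using that by (force simp: st_Suc)
  \<comment> \<open>The gap function must be fixed before \<open>A\<close> is known, so it bounds
    the thresholds of all sets that blocks within \<open>{..m}\<close> could produce.\<close>
  define f where "f m = Max (k ` st (Suc m))" for m
  have f: "k B \<le> f m" if "B \<in> st (Suc m)" for B m
    unfolding f_def using that fin_st by (intro Max_ge) auto
  \<comment> \<open>No gap precedes the first block; intersecting with a tail set makes it pass the
    threshold of the empty set.\<close>
  obtain A where A: "A \<in> FIN_block_seqs" "FIN_span A \<in> \<U>"
    "FIN_span A \<subseteq> FIN_span C \<inter> {a \<in> FIN. k {} < Min a}"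
    "\<And>j. f (Max (A j)) < Min (A (Suc j))"
    using U_sparse[OF U_Int[OF C(2) U_tail[of "k {}"]], of f] by blast
  have AC: "A j \<in> FIN_span C" for j using A(3) FIN_span_base[of A j] by blast
  have A_le: "A j \<subseteq> {..Max (A j)}" for j using FIN_block_memD[OF A(1), of j] by auto
  define Bs where "Bs = rec_nat {} (\<lambda>j B. insert (pick B (A j)) B)"
  have Bs_0: "Bs 0 = {}" and Bs_Suc: "Bs (Suc j) = insert (pick (Bs j) (A j)) (Bs j)" for j
    by (simp_all add: Bs_def)
  have fin_Bs: "finite (Bs j)" for j by (induction j) (auto simp: Bs_0 Bs_Suc)
  \<comment> \<open>The last clause makes \<open>f (Max (A j))\<close> bound the threshold of
    \<open>Bs (Suc j)\<close>, and the gap before block \<open>Suc j\<close> exceeds that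
    bound.\<close>
  have inv: "\<not> spoiled X D (Bs j) \<and> A j \<in> W (Bs j) \<and> Bs (Suc j) \<in> st (Suc (Max (A j)))" for j
  proof (induction j)
    case 0
    have "k {} < Min (A 0)" using A(3) FIN_span_base[of A 0] by blast
    then have "A 0 \<in> W {}" using k[of "{}"] empty AC by simp
    moreover have "{} \<in> st (Max (A 0))" using st_mono[of 0 "Max (A 0)"] by (simp add: st_0)
    ultimately show ?case using empty st_step[OF _ A_le] by (simp add: Bs_0 Bs_Suc)
  next
    case (Suc j)
    have ns: "\<not> spoiled X D (Bs (Suc j))" using pick(3) Suc by (simp add: Bs_Suc)
    have "k (Bs (Suc j)) < Min (A (Suc j))"
      using f[of "Bs (Suc j)" "Max (A j)"] Suc A(4)[of j] by simp
    then have "A (Suc j) \<in> W (Bs (Suc j))" using k[OF fin_Bs ns AC] by simp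
    moreover have "Suc (Max (A j)) \<le> Max (A (Suc j))"
    proof -
      have "Max (A j) < Min (A (Suc j))" using FIN_block_less[OF A(1), of j "Suc j"] by simp
      moreover have "Min (A (Suc j)) \<le> Max (A (Suc j))" using FIN_block_memD[OF A(1), of "Suc j"] by simp
      ultimately show ?thesis by simp
    qed
    then have "Bs (Suc j) \<in> st (Max (A (Suc j)))" using st_mono Suc by blast
    ultimately show ?case using ns st_step[OF _ A_le] by (simp add: Bs_Suc[of "Suc j"])
  qed
  define Y where "Y j = pick (Bs j) (A j)" for j
  have Y: "Y j \<in> nz_span X" "supp (Y j) = A j" for j using pick inv by (auto simp: Y_def)
  have Y_Bs: "Y i \<in> Bs n" if "i < n" for i n
    using that by (induction n) (auto simp: Y_def Bs_Suc less_Suc_eq)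
  have "nz_span Y \<subseteq> D"
  proof
    fix v assume v: "v \<in> nz_span Y"
    then have "v \<in> span (range Y)" by (simp add: nz_span_def)
    then obtain n c where "v = (\<Sum>i<n. c i *s Y i)" by (rule span_range_finite_sum)
    then have "v \<in> span (Bs n)" using Y_Bs by (auto intro!: span_sum span_scale intro: span_base)
    then show "v \<in> D" using v not_spoiled_subset inv[of n] by (auto simp: nz_span_def)
  qed
  moreover have "span (range Y) \<subseteq> span (range X)"
    using Y(1) by (intro span_minimal) (auto simp: nz_span_def)
  ultimately show ?thesis using that good_of_supports(1)[OF A(1,2) Y(2)] by blast
qed

text \<open>If the empty set is spoiled, refining \<open>X\<close> into the witness \<open>S\<close>
  gives the negative alternative, since a subspace equals its span. Otherwise the fusion above gives
  the positive one.\<close>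

lemma ex_decides:
  assumes X: "good X"
  obtains Z where "good Z" "span (range Z) \<subseteq> span (range X)" "decides D Z"
proof (cases "spoiled X D {}")
  case True
  then obtain S where S: "S \<in> \<U>" "\<And>V. infinite_dim_subspace V \<Longrightarrow> V \<subseteq> span (range X) \<Longrightarrow>
     supp ` (V - {0}) \<subseteq> S \<Longrightarrow> \<not> span V - {0} \<subseteq> D"
    unfolding spoiled_def by auto
  obtain Z where Z: "good Z" "span (range Z) \<subseteq> span (range X)" "supp ` nz_span Z \<subseteq> S"
    using good_refine[OF X S(1)] .
  have "\<not> V - {0} \<subseteq> D" if V: "infinite_dim_subspace V" "V \<subseteq> span (range Z)" for V
  proof -
    have "span V = V" using V(1) by (simp add: infinite_dim_subspace_def span_eq_iff)
    moreover have "supp ` (V - {0}) \<subseteq> S" using V(2) Z(3) by (auto simp: nz_span_def)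
    ultimately show ?thesis using S(2)[OF V(1) subset_trans[OF V(2) Z(2)]] by metis
  qed
  then show ?thesis using that Z by (auto simp: decides_def)
next
  case False
  obtain Y where "good Y" "span (range Y) \<subseteq> span (range X)" "nz_span Y \<subseteq> D"
    using not_spoiled_subspace[OF X False] .
  then show ?thesis using that by (auto simp: decides_def)
qed

end

section \<open>The transfinite construction\<close>

lemma finite_has_maximum_wrt:
  assumes "finite K" "K \<noteq> {}" "trans r" "\<And>x y. x \<noteq> y \<Longrightarrow> (x, y) \<in> r \<or> (y, x) \<in> r"
  obtains m where "m \<in> K" "\<And>x. x \<in> K \<Longrightarrow> x = m \<or> (x, m) \<in> r"
proof -
  have "\<exists>m\<in>K. \<forall>x\<in>K. x = m \<or> (x, m) \<in> r"
    using assms(1,2)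
  proof (induction K rule: finite_ne_induct)
    case (insert a K)
    then obtain m where m: "m \<in> K" "\<forall>x\<in>K. x = m \<or> (x, m) \<in> r" by blast
    show ?case
    proof (cases "a = m \<or> (a, m) \<in> r")
      case True
      then show ?thesis using m by blast
    next
      case False
      then have "(m, a) \<in> r" using assms(4) by blast
      then have "\<forall>x\<in>K. (x, a) \<in> r" using m(2) assms(3) by (metis transD)
      then show ?thesis by blast
    qed
  qed simp
  then show ?thesis using that by blast
qed

section \<open>Inclusion modulo finite and the step of the recursion\<close>

context supported_space
begin

lemma eventually_in_span_refl: "eventually_in_span X X"
  unfolding eventually_in_span_def by (auto intro: span_base)

lemma eventually_in_span_mono:
  assumes "eventually_in_span Y X" "span (range X) \<subseteq> span (range X')"
  shows "eventually_in_span Y X'"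
  using assms unfolding eventually_in_span_def by blast

lemma eventually_in_span_common_tail:
  assumes "finite K" "\<And>X'. X' \<in> K \<Longrightarrow> eventually_in_span X X'"
  obtains m where "\<And>X'. X' \<in> K \<Longrightarrow> span (range (\<lambda>k. X (k + m))) \<subseteq> span (range X')"
proof -
  have "\<forall>X'\<in>K. \<exists>m. \<forall>j\<ge>m. X j \<in> span (range X')"
    using assms(2) unfolding eventually_in_span_def by blast
  then obtain m where m: "\<And>X' j. X' \<in> K \<Longrightarrow> m X' \<le> j \<Longrightarrow> X j \<in> span (range X')" by metis
  have "span (range (\<lambda>k. X (k + Max (m ` K)))) \<subseteq> span (range X')" if "X' \<in> K" for X'
  proof (rule span_minimal)
    have "m X' \<le> Max (m ` K)" using assms(1) that by simp
    then have "X (k + Max (m ` K)) \<in> span (range X')" for k using m[OF that] by simp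
    then show "range (\<lambda>k. X (k + Max (m ` K))) \<subseteq> span (range X')" by blast
  qed simp
  then show ?thesis using that by blast
qed

text \<open>A vector of \<open>Z\<close> supported beyond \<open>Y m\<close> is a combination of
  later vectors of \<open>Y\<close> only.\<close>

lemma eventually_in_span_refine:
  assumes Y: "Y \<in> block_seqs" and Z: "Z \<in> block_seqs"
    and ZY: "span (range Z) \<subseteq> span (range Y)" and YX: "eventually_in_span Y X"
  shows "eventually_in_span Z X"
proof -
  obtain m where m: "\<And>j. m \<le> j \<Longrightarrow> Y j \<in> span (range X)"
    using YX unfolding eventually_in_span_def by blast
  then have sub: "span (range (\<lambda>k. Y (k + m))) \<subseteq> span (range X)" by (intro span_minimal) auto
  have "Z j \<in> span (range X)" if "Suc (Max (supp (Y m))) \<le> j" for j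
  proof -
    have "Max (supp (Y m)) < Min (supp (Z j))"
      using that FIN_block_ge[OF Z[unfolded block_supp], of j] by simp
    moreover have "Z j \<in> span (range Y)" using ZY by (auto intro: span_base)
    ultimately have "Z j \<in> span (range (\<lambda>k. Y (k + m)))" by (intro span_block_tail[OF Y])
    then show ?thesis using sub by blast
  qed
  then show ?thesis unfolding eventually_in_span_def by blast
qed

lemma eventually_in_span_block_almost_le:
  assumes Y: "Y \<in> block_seqs" and YX: "eventually_in_span Y X"
  shows "block_almost_le Y X"
proof -
  obtain m where m: "\<And>j. m \<le> j \<Longrightarrow> Y j \<in> span (range X)"
    using YX unfolding eventually_in_span_def by blast
  have F: "(\<lambda>n. supp (Y n)) \<in> FIN_block_seqs" using Y block_supp by blast
  \<comment> \<open>Cutting at this bound discards \<open>Y m\<close> and everything before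
    it.\<close>
  let ?n = "Max (supp (Y m))"
  let ?L = "LEAST i. ?n < Min (supp (Y i))"
  have "?n < Min (supp (Y ?L))"
    by (rule LeastI[of _ "Suc m"]) (use FIN_block_less[OF F, of m "Suc m"] in simp)
  have "m \<le> ?L"
  proof (rule ccontr)
    assume "\<not> m \<le> ?L"
    then have "Max (supp (Y ?L)) < Min (supp (Y m))" using FIN_block_less[OF F, of ?L m] by simp
    moreover have "Min (supp (Y i)) \<le> Max (supp (Y i))" for i using FIN_block_memD[OF F, of i] by simp
    ultimately show False using \<open>?n < Min (supp (Y ?L))\<close> by (meson leD le_less_trans less_imp_le order.trans)
  qed
  then have "span (range (block_tail Y ?n)) \<subseteq> span (range X)"
    using m by (intro span_minimal) (auto simp: block_tail_def)
  then have "block_le (block_tail Y ?n) X" by (auto simp: block_le_def nz_span_def)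
  then show ?thesis unfolding block_almost_le_def by blast
qed

text \<open>The stage of the recursion: take a good pseudointersection of the countably many earlier
  sequences, then refine it to decide \<open>D\<close>.\<close>

lemma ex_decides_below:
  assumes C: "countable C" "\<And>X. X \<in> C \<Longrightarrow> good X"
    and dir: "\<And>K. finite K \<Longrightarrow> K \<subseteq> C \<Longrightarrow> K \<noteq> {} \<Longrightarrow> \<exists>X\<in>K. \<forall>X'\<in>K. eventually_in_span X X'"
  obtains Z where "good Z" "decides D Z" "\<And>X. X \<in> C \<Longrightarrow> eventually_in_span Z X"
proof (cases "C = {}")
  case True
  then show ?thesis using ex_decides[OF good_basis] that by blast
next
  case False
  let ?X = "from_nat_into C"
  \<comment> \<open>Finite intersections make the family decreasing. Directedness provides one
    sequence with a tail in the whole intersection, so the supports stay \<U>-large.\<close>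
  define G where "G n = (\<Inter>i\<le>n. nz_span (?X i))" for n
  have "supp ` G n \<in> \<U>" for n
  proof -
    let ?K = "?X ` {..n}"
    have K: "?K \<subseteq> C" using from_nat_into[OF False] by auto
    then obtain X where X: "X \<in> ?K" "\<forall>X'\<in>?K. eventually_in_span X X'" using dir[of ?K] by auto
    obtain m where m: "\<And>X'. X' \<in> ?K \<Longrightarrow> span (range (\<lambda>k. X (k + m))) \<subseteq> span (range X')"
      using eventually_in_span_common_tail[of ?K X] X(2) by blast
    have "nz_span (\<lambda>k. X (k + m)) \<subseteq> G n" using m by (force simp: G_def nz_span_def)
    moreover have "supp ` nz_span (\<lambda>k. X (k + m)) \<in> \<U>"
      using good_shift[of X m] C(2) X(1) K by (auto simp: good_def)
    moreover have "supp ` G n \<subseteq> FIN" by (rule supp_image_FIN) (auto simp: G_def nz_span_def)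
    ultimately show ?thesis using U_mono[OF _ image_mono] by blast
  qed
  moreover have "G n \<subseteq> G m" if "m \<le> n" for m n using that by (force simp: G_def)
  ultimately obtain Y where Y: "good Y" "\<And>n. \<exists>m. \<forall>j\<ge>m. Y j \<in> G n"
    using good_pseudointersection[of G] by metis
  have YX: "eventually_in_span Y X" if X: "X \<in> C" for X
  proof -
    obtain n where n: "?X n = X" using from_nat_into_surj[OF C(1) X] by blast
    obtain m where "\<forall>j\<ge>m. Y j \<in> G n" using Y(2) by blast
    then have "\<forall>j\<ge>m. Y j \<in> span (range X)" using n by (auto simp: G_def nz_span_def)
    then show ?thesis unfolding eventually_in_span_def by blast
  qed
  obtain Z where Z: "good Z" "span (range Z) \<subseteq> span (range Y)" "decides D Z"
    using ex_decides[OF Y(1)] .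
  then have "eventually_in_span Z X" if "X \<in> C" for X
    using eventually_in_span_refine[OF _ _ Z(2) YX[OF that]] Y(1) by (auto simp: good_def)
  then show ?thesis using that Z by blast
qed

lemma eqpoll_vector_sets: "(UNIV :: 'b set set) \<approx> (UNIV :: nat set set)"
proof -
  obtain g :: "'b \<Rightarrow> nat" where "bij g"
    using countableE_infinite[OF countable_vectors infinite_vectors] by auto
  then have "bij_betw (image g) (UNIV :: 'b set set) UNIV"
    using bij_betw_Pow[of g UNIV UNIV] by simp
  then show ?thesis unfolding eqpoll_def by blast
qed

lemma uncountable_vector_sets: "uncountable (UNIV :: 'b set set)"
proof
  assume "countable (UNIV :: 'b set set)"
  then obtain h :: "'b set \<Rightarrow> nat" where "inj h" by (auto simp: countable_def)
  then have "surj (inv (e \<circ> h))" using inj_basis by (intro inj_imp_surj_inv inj_compose)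
  then show False using Cantors_theorem[of "UNIV :: 'b set"] by auto
qed

section \<open>The recursion and the filter it generates\<close>

theorem ex_p_plus_filter:
  assumes CH: continuum_hypothesis
  shows "\<exists>\<F>. p_plus_filter \<F> \<and> supp_filter \<F> = \<U>"
proof -
  obtain r :: "'b set rel" where r: "wf r" "trans r" "\<And>x. countable {y. (y, x) \<in> r}"
    "\<And>x y. x \<noteq> y \<Longrightarrow> (x, y) \<in> r \<or> (y, x) \<in> r"
    using CH_wellorder_countable_segments[OF CH eqpoll_vector_sets] by metis
  \<comment> \<open>The set \<open>D\<close> is both the position in the recursion and the set
    decided there.\<close>
  define P where "P f D Z \<longleftrightarrow> good Z \<and> decides D Z \<and> (\<forall>D'. (D', D) \<in> r \<longrightarrow> eventually_in_span Z (f D'))"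
    for f D Z
  have max: "\<exists>d\<in>K. \<forall>d'\<in>K. eventually_in_span (f d) (f d')"
    if K: "finite K" "K \<noteq> {}" and PK: "\<And>d. d \<in> K \<Longrightarrow> P f d (f d)" for K f
  proof -
    obtain d where "d \<in> K" "\<And>d'. d' \<in> K \<Longrightarrow> d' = d \<or> (d', d) \<in> r"
      using finite_has_maximum_wrt[OF K r(2,4)] by blast
    then show ?thesis using PK eventually_in_span_refl unfolding P_def by metis
  qed
  have "\<exists>f. \<forall>D. P f D (f D)"
  proof (rule dependent_wf_choice[OF r(1)])
    show "P f D Z = P g D Z" if "\<And>D'. (D', D) \<in> r \<Longrightarrow> f D' = g D'" for f g D Z
      using that by (auto simp: P_def)
    fix D f assume IH: "\<And>D'. (D', D) \<in> r \<Longrightarrow> P f D' (f D')"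
    let ?C = "f ` {D'. (D', D) \<in> r}"
    obtain Z where Z: "good Z" "decides D Z" "\<And>X. X \<in> ?C \<Longrightarrow> eventually_in_span Z X"
    proof (rule ex_decides_below[of ?C])
      show "countable ?C" using r(3) by simp
      show "good X" if "X \<in> ?C" for X using that IH by (auto simp: P_def)
      show "\<exists>X\<in>K. \<forall>X'\<in>K. eventually_in_span X X'" if K: "finite K" "K \<subseteq> ?C" "K \<noteq> {}" for K
      proof -
        obtain K' where K': "K' \<subseteq> {D'. (D', D) \<in> r}" "finite K'" "K = f ` K'"
          using finite_subset_image[OF K(1,2)] by blast
        then have "\<exists>d\<in>K'. \<forall>d'\<in>K'. eventually_in_span (f d) (f d')"
          using K(3) IH by (intro max) auto
        then show ?thesis using K'(3) by blast
      qed
    qed blast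
    then have "P f D Z" by (auto simp: P_def)
    then show "\<exists>Z. P f D Z" by blast
  qed
  then obtain f where f: "\<And>D. P f D (f D)" by blast
  have good: "good (f D)" for D using f[of D] by (simp add: P_def)
  then have block: "f D \<in> block_seqs" for D by (simp add: good_def)
  have below: "eventually_in_span (f D) (f D')" if "D' = D \<or> (D', D) \<in> r" for D D'
    using f[of D] that eventually_in_span_refl by (auto simp: P_def)
  \<comment> \<open>A single infinite-dimensional \<open>V\<close> refutes the negative alternative.
    Each filter property below comes from applying this to a suitable set.\<close>
  have decided: "nz_span (f D) \<subseteq> D"
    if "infinite_dim_subspace V" "V \<subseteq> span (range (f D))" "V - {0} \<subseteq> D" for D V
    using f[of D] that unfolding P_def decides_def by blast
  define \<F> where "\<F> = {S. S \<subseteq> UNIV - {0} \<and> (\<exists>D. nz_span (f D) \<subseteq> S)}"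
  have in_F: "nz_span (f D) \<in> \<F>" for D by (auto simp: \<F>_def nz_span_def)
  have Int: "S \<inter> T \<in> \<F>" if ST: "S \<in> \<F>" "T \<in> \<F>" for S T
  proof -
    obtain a b where ab: "nz_span (f a) \<subseteq> S" "nz_span (f b) \<subseteq> T" using ST by (auto simp: \<F>_def)
    \<comment> \<open>The spans of the chosen sequences decrease only modulo finite, so their
      intersection is itself treated as a set to be decided. A tail of the latest of the three
      sequences is the required subspace.\<close>
    let ?D = "nz_span (f a) \<inter> nz_span (f b)"
    obtain d where d: "d \<in> {a, b, ?D}" "\<forall>d'\<in>{a, b, ?D}. eventually_in_span (f d) (f d')"
      using max[of "{a, b, ?D}" f] f by blast
    then obtain m where m: "\<And>X'. X' \<in> f ` {a, b, ?D} \<Longrightarrow> span (range (\<lambda>k. f d (k + m))) \<subseteq> span (range X')"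
      using eventually_in_span_common_tail[of "f ` {a, b, ?D}" "f d"] by blast
    have "nz_span (f ?D) \<subseteq> ?D"
    proof (rule decided)
      show "infinite_dim_subspace (span (range (\<lambda>k. f d (k + m))))"
        by (rule infinite_dim_span_block[OF block_shift[OF block]])
      show "span (range (\<lambda>k. f d (k + m))) \<subseteq> span (range (f ?D))" by (rule m) simp
      show "span (range (\<lambda>k. f d (k + m))) - {0} \<subseteq> ?D"
        using m[of "f a"] m[of "f b"] by (auto simp: nz_span_def)
    qed
    then have "nz_span (f ?D) \<subseteq> S \<inter> T" using ab by blast
    moreover have "S \<inter> T \<subseteq> UNIV - {0}" using ST by (auto simp: \<F>_def)
    ultimately show ?thesis unfolding \<F>_def by blast
  qed
  have "proper_filter_on (UNIV - {0}) \<F>"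
    unfolding proper_filter_on_def
  proof (intro conjI)
    show "UNIV - {0} \<in> \<F>" by (auto simp: \<F>_def nz_span_def)
    show "{} \<notin> \<F>" using block_nonzero_span[OF block] unfolding \<F>_def by blast
    show "\<forall>A\<in>\<F>. \<forall>B\<in>\<F>. A \<inter> B \<in> \<F>" using Int by blast
  qed (auto simp: \<F>_def)
  moreover have "V - {0} \<in> \<F>" if V: "finite_codim_subspace V" for V
  proof -
    have "nz_span (f V) \<subseteq> V"
      by (rule decided[OF infinite_dim_Int_finite_codim[OF infinite_dim_span_block[OF block] V]]) auto
    then show ?thesis by (auto simp: \<F>_def nz_span_def)
  qed
  ultimately have "vs_filter \<F>" by (simp add: vs_filter_def)
  then have block_F: "block_filter \<F>"
    unfolding block_filter_def
  proof (intro conjI ballI)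
    fix S assume "S \<in> \<F>"
    then obtain D where "nz_span (f D) \<subseteq> S" unfolding \<F>_def by blast
    then show "\<exists>X\<in>block_seqs. nz_span X \<in> \<F> \<and> nz_span X \<subseteq> S" using block in_F by blast
  qed
  have p: "\<exists>Y\<in>block_seqs. nz_span Y \<in> \<F> \<and> (\<forall>n. block_almost_le Y (X n))"
    if X: "\<forall>n. X n \<in> block_seqs \<and> nz_span (X n) \<in> \<F>" for X :: "nat \<Rightarrow> nat \<Rightarrow> 'b"
  proof -
    have "\<forall>n. \<exists>D. nz_span (f D) \<subseteq> nz_span (X n)" using X by (auto simp: \<F>_def)
    then obtain d where d: "\<And>n. nz_span (f (d n)) \<subseteq> nz_span (X n)" by metis
    have "countable (\<Union>n. {y. (y, d n) \<in> r})" by (intro countable_UN r(3)) simp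
    \<comment> \<open>An index outside these countably many countable segments equals or follows
      every \<open>d n\<close>.\<close>
    then have "(\<Union>n. {y. (y, d n) \<in> r}) \<noteq> UNIV" using uncountable_vector_sets by metis
    then obtain D where D: "D \<notin> (\<Union>n. {y. (y, d n) \<in> r})" by blast
    have "block_almost_le (f D) (X n)" for n
    proof (rule eventually_in_span_block_almost_le[OF block])
      have "d n = D \<or> (d n, D) \<in> r" using D r(4) by blast
      moreover have "span (range (f (d n))) \<subseteq> span (range (X n))"
        using d[of n] span_zero by (auto simp: nz_span_def)
      ultimately show "eventually_in_span (f D) (X n)" using below eventually_in_span_mono by blast
    qed
    then show ?thesis using block in_F by blast
  qed
  have full: "D - {0} \<in> \<F>" if dense: "filter_dense \<F> D" for D
  proof -
    \<comment> \<open>Density is tested on the very sequence that decides \<open>D\<close>.\<close>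
    obtain V where V: "infinite_dim_subspace V" "V \<subseteq> nz_span (f D) \<union> {0}" "V - {0} \<subseteq> D"
      using dense block in_F unfolding filter_dense_def by blast
    have "V \<subseteq> span (range (f D))" using V(2) span_zero by (auto simp: nz_span_def)
    then have "nz_span (f D) \<subseteq> D" using decided V by blast
    then show ?thesis by (auto simp: \<F>_def nz_span_def)
  qed
  have "supp_filter \<F> = \<U>"
  proof
    show "supp_filter \<F> \<subseteq> \<U>"
    proof
      fix A assume "A \<in> supp_filter \<F>"
      then obtain S where S: "A \<subseteq> FIN" "S \<in> \<F>" "supp ` S \<subseteq> A"
        unfolding supp_filter_def by blast
      then obtain D where "nz_span (f D) \<subseteq> S" unfolding \<F>_def by blast
      then have D: "A \<subseteq> FIN" "supp ` nz_span (f D) \<subseteq> A" using S by auto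
      then show "A \<in> \<U>" using good[of D] U_mono by (auto simp: good_def)
    qed
    show "\<U> \<subseteq> supp_filter \<F>"
    proof
      fix A assume A: "A \<in> \<U>"
      \<comment> \<open>The sequence deciding this set has a good refinement inside it, which forces
        the positive alternative.\<close>
      let ?D = "{v. supp v \<in> A}"
      obtain Z where Z: "good Z" "span (range Z) \<subseteq> span (range (f ?D))" "supp ` nz_span Z \<subseteq> A"
        using good_refine[OF good A] .
      have "nz_span (f ?D) \<subseteq> ?D"
      proof (rule decided[OF infinite_dim_span_block])
        show "Z \<in> block_seqs" using Z(1) by (simp add: good_def)
        show "span (range Z) - {0} \<subseteq> ?D" using Z(3) by (auto simp: nz_span_def)
      qed (rule Z(2))
      then have "supp ` nz_span (f ?D) \<subseteq> A" by auto
      then show "A \<in> supp_filter \<F>" unfolding supp_filter_def using in_F U_FIN[OF A] by blast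
    qed
  qed
  moreover have "p_plus_filter \<F>"
    unfolding p_plus_filter_def p_filter_def full_filter_def using block_F p full by blast
  ultimately show ?thesis by blast
qed

end

theorem theorem2p8:
  fixes scale :: "'a :: field \<Rightarrow> 'b :: ab_group_add \<Rightarrow> 'b"
    and e :: "nat \<Rightarrow> 'b"
    and \<U> :: "nat set set set"
  assumes "based_vector_space scale e"
    and "continuum_hypothesis"
    and "stable_ordered_union_ultrafilter \<U>"
  shows "\<exists>\<F> :: 'b set set.
           based_vector_space.p_plus_filter scale e \<F> \<and>
           based_vector_space.supp_filter scale e \<F> = \<U>"
proof -
  interpret based_vector_space scale e by (fact assms(1))
  interpret supported_space scale e \<U> by unfold_locales (fact assms(3))
  show ?thesis by (rule ex_p_plus_filter[OF assms(2)])
qed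

end
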